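(* Let $U$ be an open subset of $\mathbb{R}^d$ and let $L_1,\ldots,L_r$ and $L$ be linear partial differential operators with coefficients from $\mathcal{C}(U)$. Then the following are equivalent: (1) For every $\phi,\psi\in\mathcal{C}^{(\infty)}_c(U)$ such that $\langle L_1\phi,\psi\rangle=\cdots=\langle L_r\phi,\psi\rangle=0$ we have $\langle L\phi,\psi\rangle=0$. (2) For every $\phi\in\mathcal{C}^{(\infty)}_c(U)$ we have $L\phi\in\mathrm{Lin}\{L_1\phi,\ldots,L_r\phi\}$. (3) $L\in\mathrm{Lin}\{L_1,\ldots,L_r\}$.
   Context: $\mathcal{C}(U)$ is the real vector space of all continuous real functions on $U$, $\mathcal{C}_c(U)$ its subspace of functions with compact support, and $\mathcal{C}^{(\infty)}_c(U)$ the real vector space of all infinitely differentiable real functions with compact support on $U$. The space $\mathcal{C}_c(U)$ has the standard inner product $\langle f,g\rangle=\int_U fg$. A linear partial differential operator with coefficients from $\mathcal{C}(U)$ is a finite sum $\sum_\alpha p_\alpha D^\alpha$ with $\alpha\in\mathbb{N}_0^d$, $p_\alpha\in\mathcal{C}(U)$, $D^\alpha=\frac{\partial^{|\alpha|}}{(\partial x_1)^{\alpha_1}\cdots(\partial x_d)^{\alpha_d}}$. $\mathrm{Lin}$ denotes the linear span over $\mathbb{R}$ (with constant real coefficients); operators are equal when their coefficient functions are equal on $U$. *)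

theory Defs
  imports "HOL-Analysis.Analysis" "HOL-Library.Function_Algebras"
begin

text \<open>
  A function on an open set \<open>U\<close> is represented by its extension by \<open>0\<close> to the whole space.
  Thus equality of such functions in HOL is equality on \<open>U\<close>, and the pointwise vector space
  structure of the function type is the one of the functions on \<open>U\<close>.  The index type \<open>'d\<close> of the
  coordinates is linearly ordered, and this order is the order of differentiation in \<open>D\<^sup>\<alpha>\<close>.
\<close>

definition cont_fun :: "(real ^ 'd) set \<Rightarrow> (real ^ 'd \<Rightarrow> real) set" where
  "cont_fun U = {f. continuous_on U f \<and> (\<forall>x. x \<notin> U \<longrightarrow> f x = 0)}"

definition partial_deriv :: "'d \<Rightarrow> (real ^ 'd \<Rightarrow> real) \<Rightarrow> real ^ 'd \<Rightarrow> real" where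
  "partial_deriv i f x = deriv (\<lambda>t. f (x + t *\<^sub>R axis i 1)) 0"

text \<open>All iterated partial derivatives exist and are Frechet differentiable.\<close>

definition inf_differentiable_on :: "(real ^ 'd \<Rightarrow> real) \<Rightarrow> (real ^ 'd) set \<Rightarrow> bool"
    (infix "inf'_differentiable'_on" 50) where
  "f inf_differentiable_on U \<longleftrightarrow> (\<forall>js. foldr partial_deriv js f differentiable_on U)"

text \<open>The support is a compact subset of \<open>U\<close>; in particular the functions vanish outside \<open>U\<close>.\<close>

definition test_fun :: "(real ^ 'd) set \<Rightarrow> (real ^ 'd \<Rightarrow> real) set" where
  "test_fun U = {f. f inf_differentiable_on U \<and>
     compact (closure {x. f x \<noteq> 0}) \<and> closure {x. f x \<noteq> 0} \<subseteq> U}"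

definition inner_on :: "(real ^ 'd) set \<Rightarrow> (real ^ 'd \<Rightarrow> real) \<Rightarrow> (real ^ 'd \<Rightarrow> real) \<Rightarrow> real" where
  "inner_on U f g = (LINT x:U|lborel. f x * g x)"

definition partial_D ::
    "('d::{finite,linorder} \<Rightarrow> nat) \<Rightarrow> (real ^ 'd::{finite,linorder} \<Rightarrow> real) \<Rightarrow> real ^ 'd::{finite,linorder} \<Rightarrow> real" where
  "partial_D \<alpha> f = foldr (\<lambda>i. partial_deriv i ^^ \<alpha> i) (sorted_list_of_set UNIV) f"

text \<open>The operator \<open>\<Sum>\<^sub>\<alpha> p\<^sub>\<alpha> D\<^sup>\<alpha>\<close> is represented by its family of coefficients \<open>p\<close>.\<close>

type_synonym 'd diff_op = "('d \<Rightarrow> nat) \<Rightarrow> real ^ 'd \<Rightarrow> real"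

definition diff_ops :: "(real ^ 'd) set \<Rightarrow> 'd diff_op set" where
  "diff_ops U = {p. (\<forall>\<alpha>. p \<alpha> \<in> cont_fun U) \<and> finite {\<alpha>. p \<alpha> \<noteq> 0}}"

definition apply_op ::
    "'d::{finite,linorder} diff_op \<Rightarrow> (real ^ 'd::{finite,linorder} \<Rightarrow> real) \<Rightarrow> real ^ 'd::{finite,linorder} \<Rightarrow> real" where
  "apply_op p f x = (\<Sum>\<alpha> | p \<alpha> \<noteq> 0. p \<alpha> x * partial_D \<alpha> f x)"

lemma vector_space_fun: "vector_space (\<lambda>(c::real) (f :: 'x \<Rightarrow> real) x. c * f x)"
  by unfold_locales (auto simp: fun_eq_iff algebra_simps)

lemma vector_space_diff_op: "vector_space (\<lambda>(c::real) (p :: 'd::finite diff_op) \<alpha> x. c * p \<alpha> x)"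
  by unfold_locales (auto simp: fun_eq_iff algebra_simps)

definition Lin_fun :: "('x \<Rightarrow> real) set \<Rightarrow> ('x \<Rightarrow> real) set" where
  "Lin_fun = module.span (\<lambda>c f x. c * f x)"

definition Lin_op :: "'d::finite diff_op set \<Rightarrow> 'd diff_op set" where
  "Lin_op = module.span (\<lambda>c p \<alpha> x. c * p \<alpha> x)"

end

theory Submission
  imports Defs
begin

text \<open>
  The step with content is that locality, \<open>L\<phi> \<in> Lin {L\<^sub>1\<phi>, \<dots>, L\<^sub>r\<phi>}\<close> for every test function
  \<open>\<phi>\<close>, forces \<open>L \<in> Lin {L\<^sub>1, \<dots>, L\<^sub>r}\<close>; a priori the coefficients of the combination depend on \<open>\<phi>\<close>.
  They are pinned down as follows.  The span of the \<open>L\<^sub>i\<close> is finite-dimensional, so finitely many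
  evaluations \<open>p \<mapsto> p\<^sub>\<alpha>(x)\<close> of coefficient functions separate its elements.  Since the coefficients are
  continuous and nonempty open sets are infinite, the evaluation points can be chosen pairwise
  distinct (\<open>separating_jets\<close>): there are a finite \<open>X \<subseteq> U\<close> and one multi-index \<open>A x\<close> for each
  \<open>x \<in> X\<close>.  A test function \<open>\<Phi>\<close> whose jet at each \<open>x \<in> X\<close> is concentrated in degree \<open>A x\<close>
  (\<open>test_fun_interpolating_jets\<close>) turns these evaluations into values: \<open>(P\<Phi>)(x)\<close> is the coefficient
  of \<open>P\<close> of index \<open>A x\<close> at \<open>x\<close>.  Hence \<open>L\<Phi>\<close> equals \<open>P\<Phi>\<close> for exactly one \<open>P\<close> in the span.
  Adding to \<open>\<Phi>\<close> a test function \<open>\<phi>\<close> supported away from \<open>X\<close> changes no value on \<open>X\<close>, so the same \<open>P\<close>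
  serves \<open>\<Phi> + \<phi>\<close>, and \<open>L\<phi> = P\<phi>\<close> follows.  Testing with all such \<open>\<phi>\<close> shows that \<open>L\<close> and \<open>P\<close> have the
  same coefficients off \<open>X\<close>, and by continuity on all of \<open>U\<close> (\<open>Lin_op_reflexive\<close>).

  The equivalence of the orthogonality condition with locality is linear algebra for each fixed \<open>\<phi>\<close>:
  if the functional \<open>\<langle>g, \<cdot>\<rangle>\<close> vanishes on the common kernel of finitely many functionals
  \<open>\<langle>g\<^sub>i, \<cdot>\<rangle>\<close>, then it is a combination of them, and because test functions separate continuous functions
  the same holds for \<open>g\<close> and the \<open>g\<^sub>i\<close> (\<open>span_of_annihilator_inclusion\<close>).

  Both parts need test functions with prescribed jets.  These are tensor products of functions of one
  variable, for which every partial derivative is again a tensor product, so the construction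
  reduces to the real line: a monomial times a plateau function, the latter being built from
  \<open>exp (-1/x)\<close> (\<open>smooth_prescribed_jet\<close>, \<open>test_fun_delta_jet\<close>).
\<close>

section \<open>Smooth functions of one variable with prescribed jets\<close>

text \<open>
  Smoothness on the line is expressed by carrying all derivatives along as data: \<open>F n\<close> is the \<open>n\<close>-th
  derivative of \<open>F 0\<close>.  Values of derivatives can then be read off without unfolding iterated limits.
\<close>

definition derivative_tower :: "(nat \<Rightarrow> real \<Rightarrow> real) \<Rightarrow> bool" where
  "derivative_tower F \<longleftrightarrow> (\<forall>n x. (F n has_real_derivative F (Suc n) x) (at x))"

text \<open>
  A class of functions, just large enough to contain the plateau functions below, for which closure
  under differentiation is visible from the rules.  That closure alone makes all its members smooth,
  so no separate Leibniz or chain rule for higher derivatives has to be proved.  The factor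
  \<open>inverse x ^ n\<close> is what differentiating \<open>exp (- inverse x)\<close> produces, and integration is included
  because a plateau arises as the antiderivative of two opposite bumps.
\<close>

inductive generated_smooth :: "(real \<Rightarrow> real) \<Rightarrow> bool" where
  flat: "generated_smooth (\<lambda>x. if 0 < x then inverse x ^ n * exp (- inverse x) else 0)"
| const: "generated_smooth (\<lambda>x. c)"
| ident: "generated_smooth (\<lambda>x. x)"
| add: "generated_smooth f \<Longrightarrow> generated_smooth g \<Longrightarrow> generated_smooth (\<lambda>x. f x + g x)"
| mult: "generated_smooth f \<Longrightarrow> generated_smooth g \<Longrightarrow> generated_smooth (\<lambda>x. f x * g x)"
| affine: "generated_smooth f \<Longrightarrow> generated_smooth (\<lambda>x. f (a * x + b))"
| antideriv: "generated_smooth f' \<Longrightarrow> (\<And>x. (f has_real_derivative f' x) (at x)) \<Longrightarrow> generated_smooth f"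

text \<open>
  Away from \<open>0\<close> this is calculus; at \<open>0\<close> the difference quotient tends to \<open>0\<close> because, with \<open>y = 1/x\<close>,
  the exponential \<open>exp y\<close> dominates \<open>y ^ (n + 1)\<close>.
\<close>

lemma flat_has_derivative:
  fixes n :: nat
  defines "flat \<equiv> \<lambda>n x::real. if 0 < x then inverse x ^ n * exp (- inverse x) else 0"
  shows "(flat n has_real_derivative flat (n + 2) x - real n * flat (n + 1) x) (at x)"
proof -
  consider "x > 0" | "x < 0" | "x = 0" by linarith
  then show ?thesis
  proof cases
    case 1
    have "((\<lambda>x. inverse x ^ n * exp (- inverse x)) has_real_derivative
        flat (n + 2) x - real n * flat (n + 1) x) (at x)"
      using 1 unfolding flat_def
      apply (auto intro!: derivative_eq_intros)
      apply (cases n)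
       apply (auto simp: field_simps power2_eq_square)
      done
    then show ?thesis
      by (rule has_field_derivative_transform_within_open[where S = "{0<..}"]) (use 1 in \<open>auto simp: flat_def\<close>)
  next
    case 2
    have "((\<lambda>x. 0) has_real_derivative flat (n + 2) x - real n * flat (n + 1) x) (at x)"
      using 2 by (auto simp: flat_def)
    then show ?thesis
      by (rule has_field_derivative_transform_within_open[where S = "{..<0}"]) (use 2 in \<open>auto simp: flat_def\<close>)
  next
    case 3
    have "((\<lambda>y::real. y ^ Suc n / exp y) \<longlongrightarrow> 0) at_top"
      by (rule tendsto_power_div_exp_0)
    then have "((\<lambda>h::real. inverse h ^ Suc n / exp (inverse h)) \<longlongrightarrow> 0) (at_right 0)"
      by (rule filterlim_compose) (rule filterlim_inverse_at_top_right)
    then have right: "((\<lambda>h. flat n h / h) \<longlongrightarrow> 0) (at_right 0)"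
      by (rule Lim_transform_eventually)
        (auto simp: flat_def eventually_at_filter exp_minus field_simps)
    have left: "((\<lambda>h. flat n h / h) \<longlongrightarrow> 0) (at_left 0)"
      by (rule Lim_transform_eventually[OF tendsto_const])
        (auto simp: flat_def eventually_at_filter)
    have "((\<lambda>h. flat n h / h) \<longlongrightarrow> 0) (at 0)"
      using left right by (simp add: filterlim_split_at_real)
    then show ?thesis
      unfolding DERIV_def 3 add_0_left by (simp add: flat_def)
  qed
qed

lemma generated_smooth_derivative:
  assumes "generated_smooth f"
  shows "\<exists>f'. generated_smooth f' \<and> (\<forall>x. (f has_real_derivative f' x) (at x))"
  using assms
proof induction
  case (flat n)
  let ?flat = "\<lambda>n x::real. if 0 < x then inverse x ^ n * exp (- inverse x) else 0"
  have "generated_smooth (\<lambda>x. ?flat (n + 2) x + (- real n) * ?flat (n + 1) x)"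
    by (intro generated_smooth.intros)
  moreover have "(?flat n has_real_derivative ?flat (n + 2) x + (- real n) * ?flat (n + 1) x) (at x)" for x
    using flat_has_derivative[of n x] by (simp only: minus_mult_left[symmetric] diff_conv_add_uminus)
  ultimately show ?case by blast
next
  case (const c)
  show ?case
    by (rule exI[of _ "\<lambda>x. 0"]) (auto intro: generated_smooth.const)
next
  case ident
  show ?case
    by (rule exI[of _ "\<lambda>x. 1"]) (auto intro: generated_smooth.const)
next
  case (add f g)
  then obtain f' g' where "generated_smooth f'" "generated_smooth g'"
    "\<And>x. (f has_real_derivative f' x) (at x)" "\<And>x. (g has_real_derivative g' x) (at x)" by blast
  then show ?case
    by (intro exI[of _ "\<lambda>x. f' x + g' x"]) (auto intro: generated_smooth.add DERIV_add)
next
  case (mult f g)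
  then obtain f' g' where "generated_smooth f'" "generated_smooth g'"
    "\<And>x. (f has_real_derivative f' x) (at x)" "\<And>x. (g has_real_derivative g' x) (at x)" by blast
  with mult.hyps show ?case
    by (intro exI[of _ "\<lambda>x. f' x * g x + g' x * f x"])
      (auto intro!: generated_smooth.add generated_smooth.mult DERIV_mult)
next
  case (affine f a b)
  then obtain f' where f': "generated_smooth f'" "\<And>x. (f has_real_derivative f' x) (at x)"
    by blast
  have "((\<lambda>x. f (a * x + b)) has_real_derivative f' (a * x + b) * a) (at x)" for x
    by (rule DERIV_chain2[OF f'(2)]) (auto intro!: derivative_eq_intros)
  then show ?case
    by (intro exI[of _ "\<lambda>x. f' (a * x + b) * a"])
      (auto intro!: generated_smooth.mult generated_smooth.affine generated_smooth.const f'(1))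
next
  case (antideriv f' f)
  then show ?case by blast
qed

lemma generated_smooth_tower:
  assumes "generated_smooth f"
  obtains F where "derivative_tower F" "F 0 = f"
proof -
  have step: "\<forall>f. \<exists>f'. generated_smooth f \<longrightarrow> generated_smooth f' \<and> (\<forall>x. (f has_real_derivative f' x) (at x))"
    using generated_smooth_derivative by blast
  then obtain D where D: "\<And>f. generated_smooth f \<Longrightarrow> generated_smooth (D f)"
    "\<And>f x. generated_smooth f \<Longrightarrow> (f has_real_derivative D f x) (at x)"
    by metis
  have "generated_smooth ((D ^^ n) f)" for n
    by (induction n) (auto intro: assms D)
  then have "derivative_tower (\<lambda>n. (D ^^ n) f)"
    by (auto simp: derivative_tower_def intro: D)
  then show thesis by (rule that) simp
qed

text \<open>
  Derivatives are local.  This yields both the vanishing of all derivatives off the support and their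
  values at points near which the function is a monomial.
\<close>

lemma derivative_tower_cong_open:
  assumes "derivative_tower F" "derivative_tower G" "open S"
    and "\<And>x. x \<in> S \<Longrightarrow> F 0 x = G 0 x" and "x \<in> S"
  shows "F n x = G n x"
  using \<open>x \<in> S\<close>
proof (induction n arbitrary: x)
  case 0
  then show ?case using assms(4) by simp
next
  case (Suc n)
  have "(F n has_real_derivative F (Suc n) x) (at x)"
    using assms(1) by (simp add: derivative_tower_def)
  then have "(G n has_real_derivative F (Suc n) x) (at x)"
    by (rule has_field_derivative_transform_within_open[OF _ \<open>open S\<close> Suc.prems Suc.IH])
  moreover have "(G n has_real_derivative G (Suc n) x) (at x)"
    using assms(2) by (simp add: derivative_tower_def)
  ultimately show ?case by (rule DERIV_unique)
qed

lemma derivative_tower_zero: "derivative_tower (\<lambda>n x. 0)"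
  by (simp add: derivative_tower_def)

lemma derivative_tower_monomial:
  "derivative_tower (\<lambda>n x. if n \<le> k then x ^ (k - n) / fact (k - n) else 0)"
proof -
  have monomial: "((\<lambda>x::real. x ^ Suc m / fact (Suc m)) has_real_derivative x ^ m / fact m) (at x)" for m x
  proof -
    have "((\<lambda>x::real. x ^ Suc m / fact (Suc m)) has_real_derivative real (Suc m) * x ^ m / fact (Suc m)) (at x)"
      by (rule DERIV_cdivide) (use DERIV_pow[of "Suc m" x] in simp)
    then show ?thesis
      by (simp add: fact_Suc del: of_nat_Suc power_Suc)
  qed
  show ?thesis
    unfolding derivative_tower_def
  proof (intro allI)
    fix n and x :: real
    show "((\<lambda>x. if n \<le> k then x ^ (k - n) / fact (k - n) else 0) has_real_derivative
        (if Suc n \<le> k then x ^ (k - Suc n) / fact (k - Suc n) else 0)) (at x)"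
    proof (cases "Suc n \<le> k")
      case True
      then have "k - n = Suc (k - Suc n)" by simp
      with True monomial[of "k - Suc n" x] show ?thesis
        by (simp only: if_True Suc_leD)
    next
      case False
      then show ?thesis
        by (cases "n = k") simp_all
    qed
  qed
qed

text \<open>
  Let \<open>b \<ge> 0\<close> be a bump supported in \<open>[-\<delta>, \<delta>]\<close> and \<open>B\<close> an antiderivative of it, which is constant on
  either side of that interval.  The difference \<open>B (x + 2\<delta>) - B (x - 2\<delta>)\<close> then climbs from \<open>0\<close> to its
  maximum on \<open>[-3\<delta>, -\<delta>]\<close>, stays there on \<open>[-\<delta>, \<delta>]\<close> and returns to \<open>0\<close> on \<open>[\<delta>, 3\<delta>]\<close>; normalising it
  gives the plateau.
\<close>

lemma smooth_plateau:
  fixes \<epsilon> :: real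
  assumes "\<epsilon> > 0"
  obtains \<theta> \<delta> where "generated_smooth \<theta>" "\<delta> > 0"
    "\<And>x. \<theta> x \<ge> 0" "\<And>x. \<bar>x\<bar> < \<delta> \<Longrightarrow> \<theta> x = 1" "\<And>x. \<bar>x\<bar> > \<epsilon> \<Longrightarrow> \<theta> x = 0"
proof -
  define \<delta> where "\<delta> = \<epsilon> / 3"
  have \<delta>: "\<delta> > 0" "\<epsilon> = 3 * \<delta>" using assms by (auto simp: \<delta>_def)
  define flat :: "real \<Rightarrow> real" where "flat = (\<lambda>x. if 0 < x then inverse x ^ 0 * exp (- inverse x) else 0)"
  define b where "b = (\<lambda>x. flat (1 * x + \<delta>) * flat ((-1) * x + \<delta>))"
  have b_smooth: "generated_smooth b"
    unfolding b_def flat_def by (intro generated_smooth.mult generated_smooth.affine generated_smooth.flat)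
  have b_nonneg: "b x \<ge> 0" for x by (simp add: b_def flat_def)
  have b_zero: "b x = 0" if "\<bar>x\<bar> \<ge> \<delta>" for x using that by (auto simp: b_def flat_def)
  have b_pos: "b 0 > 0" using \<delta> by (simp add: b_def flat_def)
  have "isCont b x" for x
    using generated_smooth_derivative[OF b_smooth] DERIV_isCont by blast
  then obtain B where B: "\<And>x. (B has_real_derivative b x) (at x)"
    using einterval_antiderivative[of "-\<infinity>" "\<infinity>" b]
    by (auto simp: has_real_derivative_iff_has_vector_derivative)
  have B_smooth: "generated_smooth B"
    using b_smooth B by (rule generated_smooth.antideriv)
  have B_mono: "B x \<le> B y" if "x \<le> y" for x y
    by (rule DERIV_nonneg_imp_nondecreasing[OF that]) (rule exI, rule conjI, rule B, rule b_nonneg)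
  have B_const: "B x = B y" if "\<And>z. min x y \<le> z \<Longrightarrow> z \<le> max x y \<Longrightarrow> b z = 0" for x y
  proof -
    have less: "B u = B v" if "u < v" "\<And>z. u \<le> z \<Longrightarrow> z \<le> v \<Longrightarrow> b z = 0" for u v
    proof -
      obtain z where "u < z" "z < v" "B v - B u = (v - u) * b z"
        using MVT2[OF \<open>u < v\<close>, of B b] B by blast
      with that(2)[of z] show ?thesis by simp
    qed
    consider "x < y" | "x = y" | "y < x" by linarith
    then show ?thesis
    proof cases
      case 1
      then show ?thesis by (intro less that) auto
    next
      case 3
      then show ?thesis by (intro less[symmetric] that) auto
    qed simp
  qed
  have B_right: "B x = B \<delta>" if "x \<ge> \<delta>" for x
    by (rule B_const) (use that b_zero \<delta> in auto)
  have B_left: "B x = B (- \<delta>)" if "x \<le> - \<delta>" for x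
    by (rule B_const) (use that b_zero \<delta> in auto)
  \<comment> \<open>If the total mass of \<open>b\<close> were zero, \<open>B\<close> would be locally constant at \<open>0\<close>, although \<open>b 0 > 0\<close>.\<close>
  have B_less: "B (- \<delta>) < B \<delta>"
  proof (rule ccontr)
    assume "\<not> ?thesis"
    then have eq: "B x = B 0" if "\<bar>x\<bar> < \<delta>" for x
      using that B_mono[of "- \<delta>" x] B_mono[of x \<delta>] B_mono[of "- \<delta>" 0] B_mono[of 0 \<delta>] \<delta> by linarith
    have "(B has_real_derivative 0) (at 0)"
      by (rule has_field_derivative_transform_within_open[where f = "\<lambda>x. B 0" and S = "{- \<delta><..<\<delta>}"])
        (use \<delta> eq[symmetric] in auto)
    with B[of 0] have "b 0 = 0" by (metis DERIV_unique)
    with b_pos show False by simp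
  qed
  define c where "c = inverse (B \<delta> - B (- \<delta>))"
  \<comment> \<open>The factors \<open>1\<close> and \<open>-1\<close> fit the terms to the shape of the rules of \<open>generated_smooth\<close>.\<close>
  define \<theta> where "\<theta> = (\<lambda>x. c * (B (1 * x + 2 * \<delta>) + (-1) * B (1 * x + (- 2 * \<delta>))))"
  show thesis
  proof
    show "generated_smooth \<theta>"
      unfolding \<theta>_def by (intro generated_smooth.intros(2,4,5,6) B_smooth)
    show "\<theta> x \<ge> 0" for x
      using B_mono[of "x - 2 * \<delta>" "x + 2 * \<delta>"] B_less \<delta> by (simp add: \<theta>_def c_def)
    show "\<theta> x = 1" if "\<bar>x\<bar> < \<delta>" for x
      using that B_right[of "x + 2 * \<delta>"] B_left[of "x - 2 * \<delta>"] B_less by (simp add: \<theta>_def c_def)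
    show "\<theta> x = 0" if "\<bar>x\<bar> > \<epsilon>" for x
    proof (cases "x > 0")
      case True
      with that show ?thesis
        using B_right[of "x + 2 * \<delta>"] B_right[of "x - 2 * \<delta>"] \<delta> by (simp add: \<theta>_def)
    next
      case False
      with that show ?thesis
        using B_left[of "x + 2 * \<delta>"] B_left[of "x - 2 * \<delta>"] \<delta> by (simp add: \<theta>_def)
    qed
  qed (rule \<delta>(1))
qed

lemma generated_smooth_power: "generated_smooth (\<lambda>x. x ^ n)"
  by (induction n) (auto intro: generated_smooth.intros)

text \<open>
  The function is \<open>x ^ k / k!\<close> times a plateau around \<open>0\<close>: near \<open>0\<close> the plateau is invisible, so the
  derivatives at \<open>0\<close> are those of the monomial.  Nonnegativity, for \<open>k = 0\<close>, is what a positive test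
  function in several variables is later made from.
\<close>

lemma smooth_prescribed_jet:
  fixes \<epsilon> :: real
  assumes "\<epsilon> > 0"
  obtains F where "derivative_tower F" "\<And>n x. \<bar>x\<bar> > \<epsilon> \<Longrightarrow> F n x = 0"
    "\<And>n. F n 0 = (if n = k then 1 else 0)" "k = 0 \<Longrightarrow> (\<forall>x. F 0 x \<ge> 0)"
proof -
  obtain \<theta> \<delta> where \<theta>: "generated_smooth \<theta>" "\<delta> > 0" "\<And>x. \<theta> x \<ge> 0"
    "\<And>x. \<bar>x\<bar> < \<delta> \<Longrightarrow> \<theta> x = 1" "\<And>x. \<bar>x\<bar> > \<epsilon> \<Longrightarrow> \<theta> x = 0"
    by (rule smooth_plateau[OF assms]) (rule that)
  have "generated_smooth (\<lambda>x. (x ^ k * inverse (fact k)) * \<theta> x)"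
    by (intro generated_smooth.mult generated_smooth_power generated_smooth.const \<theta>)
  then obtain F where F: "derivative_tower F" "F 0 = (\<lambda>x. (x ^ k * inverse (fact k)) * \<theta> x)"
    by (rule generated_smooth_tower)
  show thesis
  proof
    show "F n x = 0" if "\<bar>x\<bar> > \<epsilon>" for n x
      by (rule derivative_tower_cong_open[OF F(1) derivative_tower_zero, of "{x. \<bar>x\<bar> > \<epsilon>}"])
        (use that in \<open>auto intro!: open_Collect_less continuous_intros simp: F(2) \<theta>\<close>)
    have "F n 0 = (if n \<le> k then 0 ^ (k - n) / fact (k - n) else 0)" for n
      by (rule derivative_tower_cong_open[OF F(1) derivative_tower_monomial, of "{-\<delta><..<\<delta>}"])
        (use \<theta> in \<open>auto simp: F(2) field_simps\<close>)
    then show "F n 0 = (if n = k then 1 else 0)" for n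
      by (auto simp: power_0_left)
    show "k = 0 \<Longrightarrow> (\<forall>x. F 0 x \<ge> 0)"
      by (simp add: F(2) \<theta>)
  qed (rule F(1))
qed

section \<open>Test functions as tensor products\<close>

text \<open>
  The partial derivative of order \<open>\<alpha>\<close> of the tensor product of the functions \<open>F i 0\<close>, centred at \<open>a\<close>.
  For \<open>\<alpha> = 0\<close> it is the tensor product itself.
\<close>

definition tensor_derivative ::
    "('d::finite \<Rightarrow> nat \<Rightarrow> real \<Rightarrow> real) \<Rightarrow> real ^ 'd \<Rightarrow> ('d \<Rightarrow> nat) \<Rightarrow> real ^ 'd \<Rightarrow> real" where
  "tensor_derivative F a \<alpha> x = (\<Prod>i\<in>UNIV. F i (\<alpha> i) (x $ i - a $ i))"

lemma tensor_derivative_differentiable: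
  assumes "\<And>i. derivative_tower (F i)"
  shows "tensor_derivative F a \<alpha> differentiable (at x)"
proof -
  have "(\<lambda>x. F i (\<alpha> i) (x $ i - a $ i)) differentiable (at x)" for i
  proof -
    have "F i (\<alpha> i) differentiable (at (x $ i - a $ i))"
      using assms[of i] by (auto simp: derivative_tower_def real_differentiable_def)
    moreover have "(\<lambda>x. x $ i - a $ i) differentiable (at x)"
      by (intro differentiable_diff differentiable_const bounded_linear_imp_differentiable bounded_linear_vec_nth)
    ultimately show ?thesis
      using differentiable_compose[of "F i (\<alpha> i)" "\<lambda>x. x $ i - a $ i" x UNIV] by simp
  qed
  then obtain D where "\<And>i. ((\<lambda>x. F i (\<alpha> i) (x $ i - a $ i)) has_derivative D i) (at x)"
    unfolding differentiable_def by metis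
  then have "((\<lambda>x. \<Prod>i\<in>UNIV. F i (\<alpha> i) (x $ i - a $ i)) has_derivative
      (\<lambda>y. \<Sum>i\<in>UNIV. D i y * (\<Prod>j\<in>UNIV - {i}. F j (\<alpha> j) (x $ j - a $ j)))) (at x)"
    by (intro has_derivative_prod)
  then show ?thesis
    unfolding differentiable_def tensor_derivative_def[abs_def] by blast
qed

lemma partial_deriv_tensor_derivative:
  assumes "\<And>i. derivative_tower (F i)"
  shows "partial_deriv j (tensor_derivative F a \<alpha>) = tensor_derivative F a (\<alpha>(j := Suc (\<alpha> j)))"
proof
  fix x
  let ?R = "\<Prod>i\<in>UNIV - {j}. F i (\<alpha> i) (x $ i - a $ i)"
  have split: "tensor_derivative F a \<beta> y =
      F j (\<beta> j) (y $ j - a $ j) * (\<Prod>i\<in>UNIV - {j}. F i (\<beta> i) (y $ i - a $ i))" for \<beta> y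
    unfolding tensor_derivative_def by (subst prod.remove[of _ j]) auto
  have along: "tensor_derivative F a \<alpha> (x + t *\<^sub>R axis j 1) = F j (\<alpha> j) (t + (x $ j - a $ j)) * ?R" for t
    unfolding split by (auto simp: axis_def algebra_simps intro!: prod.cong)
  have "((\<lambda>t. F j (\<alpha> j) (t + (x $ j - a $ j))) has_real_derivative F j (Suc (\<alpha> j)) (x $ j - a $ j)) (at 0)"
    by (rule DERIV_shift[THEN iffD1]) (use assms[of j] in \<open>simp add: derivative_tower_def\<close>)
  then have "((\<lambda>t. F j (\<alpha> j) (t + (x $ j - a $ j)) * ?R) has_real_derivative
      F j (Suc (\<alpha> j)) (x $ j - a $ j) * ?R) (at 0)"
    by (rule DERIV_cmult_right)
  then have "deriv (\<lambda>t. tensor_derivative F a \<alpha> (x + t *\<^sub>R axis j 1)) 0 =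
      F j (Suc (\<alpha> j)) (x $ j - a $ j) * ?R"
    unfolding along by (rule DERIV_imp_deriv)
  then show "partial_deriv j (tensor_derivative F a \<alpha>) x = tensor_derivative F a (\<alpha>(j := Suc (\<alpha> j))) x"
    unfolding partial_deriv_def split by simp
qed

lemma foldr_partial_deriv_tensor_derivative:
  assumes "\<And>i. derivative_tower (F i)"
  shows "foldr partial_deriv js (tensor_derivative F a \<alpha>) = tensor_derivative F a (\<lambda>i. \<alpha> i + count_list js i)"
proof (induction js)
  case (Cons j js)
  then show ?case
    by (auto simp: partial_deriv_tensor_derivative[OF assms] intro!: arg_cong[of _ _ "tensor_derivative F a"])
qed simp

text \<open>
  Writing \<open>D\<^sup>\<alpha>\<close> as an iteration of \<open>partial_deriv\<close> along a list makes the facts about arbitrary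
  iterated derivatives, in terms of which test functions are defined, applicable to it.
\<close>

definition derivative_list :: "('d::{finite,linorder} \<Rightarrow> nat) \<Rightarrow> 'd list" where
  "derivative_list \<alpha> = concat (map (\<lambda>i. replicate (\<alpha> i) i) (sorted_list_of_set UNIV))"

lemma partial_D_eq_foldr: "partial_D \<alpha> f = foldr partial_deriv (derivative_list \<alpha>) f"
proof -
  have "foldr (\<lambda>i. partial_deriv i ^^ \<alpha> i) xs f =
      foldr partial_deriv (concat (map (\<lambda>i. replicate (\<alpha> i) i) xs)) f" for xs
    by (induction xs) auto
  then show ?thesis
    unfolding partial_D_def derivative_list_def .
qed

lemma count_derivative_list: "count_list (derivative_list \<alpha>) i = \<alpha> i"
proof -
  have replicate: "count_list (replicate n j) i = (if j = i then n else 0)" for n j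
    by (induction n) auto
  have "distinct xs \<Longrightarrow> count_list (concat (map (\<lambda>i. replicate (\<alpha> i) i) xs)) i =
      (if i \<in> set xs then \<alpha> i else 0)" for xs
    by (induction xs) (auto simp: replicate)
  then show ?thesis
    by (simp add: derivative_list_def)
qed

lemma partial_D_tensor_derivative:
  assumes "\<And>i. derivative_tower (F i)"
  shows "partial_D \<beta> (tensor_derivative F a (\<lambda>i. 0)) = tensor_derivative F a \<beta>"
  by (simp add: partial_D_eq_foldr foldr_partial_deriv_tensor_derivative[OF assms] count_derivative_list)

lemma foldr_partial_deriv_eventually_zero:
  assumes "open S" "\<And>x. x \<in> S \<Longrightarrow> f x = 0" "x \<in> S"
  shows "foldr partial_deriv js f x = 0"
  using \<open>x \<in> S\<close>
proof (induction js arbitrary: x)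
  case (Cons j js)
  let ?g = "foldr partial_deriv js f"
  have "((\<lambda>t. ?g (x + t *\<^sub>R axis j 1)) has_real_derivative 0) (at 0)"
  proof (rule has_field_derivative_transform_within_open[where f = "\<lambda>t. 0"])
    show "open ((\<lambda>t. x + t *\<^sub>R axis j 1) -` S)"
      by (intro open_vimage assms(1) continuous_intros)
  qed (use Cons in auto)
  then show ?case
    by (simp add: partial_deriv_def[of j ?g] DERIV_imp_deriv)
qed (use assms in auto)

lemma partial_derivs_zero_off_support:
  assumes "x \<notin> closure {x. \<phi> x \<noteq> 0}"
  shows "foldr partial_deriv js \<phi> x = 0"
proof (rule foldr_partial_deriv_eventually_zero)
  show "open (- closure {x. \<phi> x \<noteq> 0})" by (rule open_Compl) (rule closed_closure)
  show "\<phi> y = 0" if "y \<in> - closure {x. \<phi> x \<noteq> 0}" for y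
  proof (rule ccontr)
    assume "\<phi> y \<noteq> 0"
    then have "y \<in> closure {x. \<phi> x \<noteq> 0}" by (intro subsetD[OF closure_subset] CollectI)
    with that show False by simp
  qed
  show "x \<in> - closure {x. \<phi> x \<noteq> 0}" using assms by simp
qed

lemma test_fun_zero_outside:
  assumes "\<phi> \<in> test_fun U" "x \<notin> U"
  shows "foldr partial_deriv js \<phi> x = 0"
proof (rule partial_derivs_zero_off_support)
  show "x \<notin> closure {x. \<phi> x \<noteq> 0}" using assms unfolding test_fun_def by blast
qed

text \<open>
  Differentiability is required of a test function on \<open>U\<close> only, but the derivatives also vanish near
  every point outside the support, so it holds everywhere and test functions on different open sets
  can be added and differentiated freely.
\<close>

lemma test_fun_differentiable:
  assumes "open U" "\<phi> \<in> test_fun U"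
  shows "foldr partial_deriv js \<phi> differentiable (at x)"
proof (cases "x \<in> U")
  case True
  have "foldr partial_deriv js \<phi> differentiable_on U"
    using assms unfolding test_fun_def inf_differentiable_on_def by blast
  then show ?thesis
    using True \<open>open U\<close> by (metis differentiable_on_def at_within_open)
next
  case False
  let ?S = "- closure {x. \<phi> x \<noteq> 0}"
  have "x \<in> ?S" using False assms unfolding test_fun_def by blast
  have "(foldr partial_deriv js \<phi> has_derivative (\<lambda>_. 0)) (at x)"
  proof (rule has_derivative_transform_within_open[OF has_derivative_const])
    show "open ?S" by (rule open_Compl) (rule closed_closure)
    show "0 = foldr partial_deriv js \<phi> y" if "y \<in> ?S" for y
      using that partial_derivs_zero_off_support[of y \<phi> js] by simp
  qed fact
  then show ?thesis unfolding differentiable_def by blast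
qed

lemma test_fun_mono:
  assumes "open V" "V \<subseteq> U"
  shows "test_fun V \<subseteq> test_fun U"
proof
  fix \<phi> assume "\<phi> \<in> test_fun V"
  then have "foldr partial_deriv js \<phi> differentiable_on U" for js
    by (intro differentiable_at_imp_differentiable_on test_fun_differentiable[OF \<open>open V\<close>])
  with \<open>\<phi> \<in> test_fun V\<close> \<open>V \<subseteq> U\<close> show "\<phi> \<in> test_fun U"
    unfolding test_fun_def inf_differentiable_on_def by blast
qed

lemma foldr_partial_deriv_linear:
  assumes "open U" "\<phi> \<in> test_fun U" "\<psi> \<in> test_fun U"
  shows "foldr partial_deriv js (\<lambda>x. a * \<phi> x + b * \<psi> x) =
      (\<lambda>x. a * foldr partial_deriv js \<phi> x + b * foldr partial_deriv js \<psi> x)"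
proof (induction js)
  case (Cons j js)
  have line: "((\<lambda>t. foldr partial_deriv js \<rho> (x + t *\<^sub>R axis j 1)) has_real_derivative
      partial_deriv j (foldr partial_deriv js \<rho>) x) (at 0)"
    if "\<rho> \<in> test_fun U" for \<rho> x
  proof -
    have "(\<lambda>t. x + t *\<^sub>R axis j 1) differentiable (at (0::real))"
      by (intro differentiable_add differentiable_const differentiable_scaleR differentiable_ident)
    then have "(\<lambda>t. foldr partial_deriv js \<rho> (x + t *\<^sub>R axis j 1)) differentiable (at 0)"
      using differentiable_compose[of "foldr partial_deriv js \<rho>" "\<lambda>t. x + t *\<^sub>R axis j 1" 0 UNIV]
        test_fun_differentiable[OF \<open>open U\<close> that] by simp
    then show ?thesis
      unfolding partial_deriv_def[of j "foldr partial_deriv js \<rho>"]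
      by (metis real_differentiable_def DERIV_imp_deriv)
  qed
  have "partial_deriv j (\<lambda>x. a * foldr partial_deriv js \<phi> x + b * foldr partial_deriv js \<psi> x) x =
      a * partial_deriv j (foldr partial_deriv js \<phi>) x + b * partial_deriv j (foldr partial_deriv js \<psi>) x" for x
    unfolding partial_deriv_def[of j "\<lambda>x. a * foldr partial_deriv js \<phi> x + b * foldr partial_deriv js \<psi> x"]
    by (intro DERIV_imp_deriv DERIV_add DERIV_cmult line assms)
  then show ?case
    by (simp add: Cons.IH fun_eq_iff)
qed simp

lemma test_fun_linear:
  assumes "open U" "\<phi> \<in> test_fun U" "\<psi> \<in> test_fun U"
  shows "(\<lambda>x. a * \<phi> x + b * \<psi> x) \<in> test_fun U"
proof -
  let ?S = "closure {x. \<phi> x \<noteq> 0} \<union> closure {x. \<psi> x \<noteq> 0}"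
  have "compact ?S" "?S \<subseteq> U"
    using assms by (auto simp: test_fun_def)
  moreover have "closure {x. a * \<phi> x + b * \<psi> x \<noteq> 0} \<subseteq> ?S"
    unfolding closure_Un[symmetric] by (rule closure_mono) auto
  ultimately have "compact (closure {x. a * \<phi> x + b * \<psi> x \<noteq> 0})" "closure {x. a * \<phi> x + b * \<psi> x \<noteq> 0} \<subseteq> U"
    unfolding compact_eq_bounded_closed using bounded_subset closed_closure by (blast, blast)
  moreover have "(\<lambda>x. a * foldr partial_deriv js \<phi> x + b * foldr partial_deriv js \<psi> x) differentiable_on U" for js
    by (intro differentiable_at_imp_differentiable_on derivative_intros test_fun_differentiable[OF \<open>open U\<close>] assms)
  ultimately show ?thesis
    by (simp add: test_fun_def inf_differentiable_on_def foldr_partial_deriv_linear[OF assms])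
qed

lemma test_fun_zero: "(\<lambda>x. 0) \<in> test_fun U"
proof -
  have "foldr partial_deriv js (\<lambda>x::real^'a. 0) = (\<lambda>x. 0)" for js
    using foldr_partial_deriv_eventually_zero[of UNIV "\<lambda>x. 0"] by auto
  then show ?thesis
    by (simp add: test_fun_def inf_differentiable_on_def)
qed

text \<open>
  The tensor product of one-variable functions with the jets \<open>\<alpha> i\<close>, each supported in an interval so
  short that the resulting box lies in a ball contained in \<open>U\<close>.
\<close>

lemma test_fun_delta_jet:
  fixes U :: "(real ^ 'd::{finite,linorder}) set"
  assumes "open U" "a \<in> U"
  obtains \<phi> where "\<phi> \<in> test_fun U" "\<And>\<beta>. partial_D \<beta> \<phi> a = (if \<beta> = \<alpha> then 1 else 0)"
    "\<alpha> = (\<lambda>i. 0) \<Longrightarrow> (\<forall>x. \<phi> x \<ge> 0)"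
proof -
  obtain e where e: "e > 0" "cball a e \<subseteq> U"
    using assms open_contains_cball by blast
  \<comment> \<open>With this side length the box lies in the ball by \<open>norm x \<le> (\<Sum>i. \<bar>x $ i\<bar>)\<close>.\<close>
  define \<epsilon> where "\<epsilon> = e / real (CARD('d))"
  have "\<epsilon> > 0" using e by (simp add: \<epsilon>_def)
  have "\<exists>F. derivative_tower F \<and> (\<forall>n x. \<bar>x\<bar> > \<epsilon> \<longrightarrow> F n x = 0) \<and>
    (\<forall>n. F n 0 = (if n = \<alpha> i then 1 else 0)) \<and> (\<alpha> i = 0 \<longrightarrow> (\<forall>x. F 0 x \<ge> 0))" for i
    using smooth_prescribed_jet[OF \<open>\<epsilon> > 0\<close>, of "\<alpha> i"] by metis
  then obtain F where F: "\<And>i. derivative_tower (F i)"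
    "\<And>i n x. \<bar>x\<bar> > \<epsilon> \<Longrightarrow> F i n x = 0" "\<And>i n. F i n 0 = (if n = \<alpha> i then 1 else 0)"
    "\<And>i x. \<alpha> i = 0 \<Longrightarrow> F i 0 x \<ge> 0"
    by metis
  define \<phi> where "\<phi> = tensor_derivative F a (\<lambda>i. 0)"
  have "x \<in> cball a e" if "\<phi> x \<noteq> 0" for x
  proof -
    have "\<bar>(x - a) $ i\<bar> \<le> \<epsilon>" for i
      using that F(2)[of "x $ i - a $ i" i 0]
      by (auto simp: \<phi>_def tensor_derivative_def not_less[symmetric])
    then have "norm (x - a) \<le> (\<Sum>i\<in>(UNIV::'d set). \<epsilon>)"
      by (intro order.trans[OF norm_le_l1_cart] sum_mono)
    then show ?thesis
      by (simp add: \<epsilon>_def dist_norm norm_minus_commute)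
  qed
  then have supp: "closure {x. \<phi> x \<noteq> 0} \<subseteq> cball a e"
    by (intro closure_minimal) auto
  show thesis
  proof
    have "compact (closure {x. \<phi> x \<noteq> 0})"
      using supp bounded_cball bounded_subset by (auto simp: compact_eq_bounded_closed)
    moreover have "\<phi> inf_differentiable_on U"
      unfolding inf_differentiable_on_def \<phi>_def foldr_partial_deriv_tensor_derivative[OF F(1)]
      by (intro allI differentiable_at_imp_differentiable_on tensor_derivative_differentiable F(1))
    ultimately show "\<phi> \<in> test_fun U"
      using supp e by (auto simp: test_fun_def)
    show "partial_D \<beta> \<phi> a = (if \<beta> = \<alpha> then 1 else 0)" for \<beta>
      unfolding \<phi>_def partial_D_tensor_derivative[OF F(1)]
      by (auto simp: tensor_derivative_def F(3) fun_eq_iff)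
    show "\<forall>x. \<phi> x \<ge> 0" if "\<alpha> = (\<lambda>i. 0)"
      using that by (auto simp: \<phi>_def tensor_derivative_def intro!: prod_nonneg F(4))
  qed
qed

section \<open>Differential operators on test functions\<close>

interpretation fn: vector_space "\<lambda>(c::real) (f :: 'x \<Rightarrow> real) x. c * f x"
  by (rule vector_space_fun)

interpretation op: vector_space "\<lambda>(c::real) (p :: 'd::finite diff_op) \<alpha> x. c * p \<alpha> x"
  by (rule vector_space_diff_op)

lemma partial_D_linear:
  assumes "open U" "\<phi> \<in> test_fun U" "\<psi> \<in> test_fun U"
  shows "partial_D \<alpha> (\<lambda>x. a * \<phi> x + b * \<psi> x) x = a * partial_D \<alpha> \<phi> x + b * partial_D \<alpha> \<psi> x"
  by (simp add: partial_D_eq_foldr foldr_partial_deriv_linear[OF assms])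

lemma partial_D_zero_outside:
  assumes "\<phi> \<in> test_fun U" "x \<notin> U"
  shows "partial_D \<alpha> \<phi> x = 0"
  by (simp add: partial_D_eq_foldr test_fun_zero_outside[OF assms])

lemma partial_D_order_zero: "partial_D (\<lambda>i. 0) f = f"
proof -
  have "foldr (\<lambda>i g. g) xs f = f" for xs :: "'a list"
    by (induction xs) auto
  then show ?thesis by (simp add: partial_D_def id_def)
qed

text \<open>
  Jets at finitely many points can be prescribed independently: a function with the right jet at \<open>a\<close> is
  taken with support off the other points, and one for the other points with support off \<open>a\<close>, so that
  in their sum neither disturbs the other.
\<close>

lemma test_fun_interpolating_jets:
  assumes "finite X" "X \<subseteq> U" "open U"
  shows "\<exists>\<Phi>\<in>test_fun U. \<forall>x\<in>X. \<forall>\<beta>. partial_D \<beta> \<Phi> x = (if \<beta> = A x then 1 else 0)"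
  using assms
proof (induction X arbitrary: U)
  case empty
  then show ?case using test_fun_zero by blast
next
  case (insert a X)
  have op: "open (U - {a})" "open (U - X)"
    using insert.hyps insert.prems by (auto intro: open_Diff finite_imp_closed)
  obtain \<Phi> where \<Phi>: "\<Phi> \<in> test_fun (U - {a})"
    "\<And>x \<beta>. x \<in> X \<Longrightarrow> partial_D \<beta> \<Phi> x = (if \<beta> = A x then 1 else 0)"
    using insert.IH[OF _ op(1)] insert.hyps insert.prems by blast
  obtain \<phi> where \<phi>: "\<phi> \<in> test_fun (U - X)" "\<And>\<beta>. partial_D \<beta> \<phi> a = (if \<beta> = A a then 1 else 0)"
  proof (rule test_fun_delta_jet[OF op(2), of a "A a"])
    show "a \<in> U - X" using insert.hyps insert.prems by blast
  qed (rule that)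
  have in_U: "\<Phi> \<in> test_fun U" "\<phi> \<in> test_fun U"
    using \<Phi>(1) \<phi>(1) test_fun_mono[OF op(1), of U] test_fun_mono[OF op(2), of U] by blast+
  let ?\<Psi> = "\<lambda>x. 1 * \<Phi> x + 1 * \<phi> x"
  have "partial_D \<beta> ?\<Psi> x = (if \<beta> = A x then 1 else 0)" if x: "x \<in> insert a X" for x \<beta>
  proof (cases "x = a")
    case True
    have "partial_D \<beta> \<Phi> a = 0"
      by (rule partial_D_zero_outside[OF \<Phi>(1)]) simp
    then show ?thesis
      unfolding partial_D_linear[OF \<open>open U\<close> in_U] True by (simp add: \<phi>(2))
  next
    case False
    then have "x \<in> X" using x by simp
    have "partial_D \<beta> \<phi> x = 0"
      by (rule partial_D_zero_outside[OF \<phi>(1)]) (use \<open>x \<in> X\<close> in simp)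
    then show ?thesis
      unfolding partial_D_linear[OF \<open>open U\<close> in_U] by (simp add: \<Phi>(2) \<open>x \<in> X\<close>)
  qed
  with test_fun_linear[OF \<open>open U\<close> in_U, of 1 1] show ?case by blast
qed

text \<open>
  The index set in the definition of \<open>apply_op\<close> depends on the operator; a common larger one is needed
  to compare or add operators.
\<close>

lemma apply_op_eq_sum:
  assumes "finite B" "{\<alpha>. p \<alpha> \<noteq> 0} \<subseteq> B"
  shows "apply_op p f x = (\<Sum>\<alpha>\<in>B. p \<alpha> x * partial_D \<alpha> f x)"
  unfolding apply_op_def using assms by (intro sum.mono_neutral_left) auto

lemma diff_ops_finite: "p \<in> diff_ops U \<Longrightarrow> finite {\<alpha>. p \<alpha> \<noteq> 0}"
  by (simp add: diff_ops_def)

lemma apply_op_linear: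
  assumes "open U" "\<phi> \<in> test_fun U" "\<psi> \<in> test_fun U"
  shows "apply_op p (\<lambda>x. a * \<phi> x + b * \<psi> x) x = a * apply_op p \<phi> x + b * apply_op p \<psi> x"
  unfolding apply_op_def partial_D_linear[OF assms]
  by (simp add: sum.distrib sum_distrib_left algebra_simps)

lemma apply_op_linear_op:
  assumes "p \<in> diff_ops U" "q \<in> diff_ops U"
  shows "apply_op (\<lambda>\<alpha> x. a * p \<alpha> x + b * q \<alpha> x) f x = a * apply_op p f x + b * apply_op q f x"
proof -
  let ?B = "{\<alpha>. p \<alpha> \<noteq> 0} \<union> {\<alpha>. q \<alpha> \<noteq> 0}"
  have "finite ?B" using assms by (simp add: diff_ops_finite)
  moreover have "{\<alpha>. (\<lambda>x. a * p \<alpha> x + b * q \<alpha> x) \<noteq> 0} \<subseteq> ?B"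
    by (auto simp: fun_eq_iff)
  ultimately show ?thesis
    by (simp add: apply_op_eq_sum[of ?B] sum.distrib sum_distrib_left algebra_simps)
qed

text \<open>
  Evaluation of a coefficient function is the action on a test function with the corresponding jet.
  This is the link between the coefficients of an operator and its action.
\<close>

lemma apply_op_jet:
  assumes "p \<in> diff_ops U" "\<And>\<beta>. partial_D \<beta> \<phi> x = (if \<beta> = \<alpha> then 1 else 0)"
  shows "apply_op p \<phi> x = p \<alpha> x"
proof -
  have "apply_op p \<phi> x = (\<Sum>\<beta>\<in>insert \<alpha> {\<beta>. p \<beta> \<noteq> 0}. p \<beta> x * (if \<beta> = \<alpha> then 1 else 0))"
    using diff_ops_finite[OF assms(1)] assms(2) by (subst apply_op_eq_sum[of "insert \<alpha> {\<beta>. p \<beta> \<noteq> 0}"]) auto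
  also have "\<dots> = p \<alpha> x"
    using diff_ops_finite[OF assms(1)] by (subst sum.remove[of _ \<alpha>]) auto
  finally show ?thesis .
qed

lemma subspace_cont_fun: "fn.subspace (cont_fun U)"
  by (auto simp: fn.subspace_def cont_fun_def zero_fun_def plus_fun_def intro!: continuous_intros)

lemma subspace_diff_ops: "op.subspace (diff_ops U)"
proof (rule op.subspaceI)
  show "0 \<in> diff_ops U"
    by (simp add: diff_ops_def cont_fun_def zero_fun_def)
next
  fix p q :: "'a diff_op" assume pq: "p \<in> diff_ops U" "q \<in> diff_ops U"
  have "finite {\<alpha>. (p + q) \<alpha> \<noteq> 0}"
    by (rule finite_subset[of _ "{\<alpha>. p \<alpha> \<noteq> 0} \<union> {\<alpha>. q \<alpha> \<noteq> 0}"]) (use pq in \<open>auto simp: diff_ops_def\<close>)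
  moreover have "p \<alpha> + q \<alpha> \<in> cont_fun U" for \<alpha>
    using pq by (intro fn.subspace_add[OF subspace_cont_fun]) (auto simp: diff_ops_def)
  ultimately show "p + q \<in> diff_ops U"
    by (simp add: diff_ops_def)
next
  fix c and p :: "'a diff_op" assume p: "p \<in> diff_ops U"
  have "finite {\<alpha>. (\<lambda>x. c * p \<alpha> x) \<noteq> 0}"
    by (rule finite_subset[of _ "{\<alpha>. p \<alpha> \<noteq> 0}"]) (use p in \<open>auto simp: diff_ops_def fun_eq_iff\<close>)
  moreover have "(\<lambda>x. c * p \<alpha> x) \<in> cont_fun U" for \<alpha>
    using p by (intro fn.subspace_scale[OF subspace_cont_fun]) (auto simp: diff_ops_def)
  ultimately show "(\<lambda>\<alpha> x. c * p \<alpha> x) \<in> diff_ops U"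
    by (simp add: diff_ops_def)
qed

lemma Lin_op_subset_diff_ops:
  assumes "B \<subseteq> diff_ops U"
  shows "Lin_op B \<subseteq> diff_ops U"
  unfolding Lin_op_def by (rule op.span_minimal[OF assms subspace_diff_ops])

lemma apply_op_add_op:
  assumes "p \<in> diff_ops U" "q \<in> diff_ops U"
  shows "apply_op (p + q) f = apply_op p f + apply_op q f"
  using apply_op_linear_op[OF assms, of 1 1 f] by (simp add: plus_fun_def fun_eq_iff)

lemma apply_op_scale_op:
  assumes "p \<in> diff_ops U"
  shows "apply_op (\<lambda>\<alpha> x. c * p \<alpha> x) f = (\<lambda>x. c * apply_op p f x)"
  using apply_op_linear_op[OF assms assms, of c 0 f] by (simp add: fun_eq_iff)

text \<open>
  Membership in \<open>Lin {L\<^sub>1\<phi>, \<dots>, L\<^sub>r\<phi>}\<close> becomes the existence of an operator \<open>P\<close> in the span of the \<open>L\<^sub>i\<close>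
  that agrees with the given one on \<open>\<phi>\<close>.  The operators have to stay in \<open>diff_ops U\<close>, since
  \<open>apply_op\<close> is not additive on families with infinitely many nonzero coefficients.
\<close>

lemma Lin_fun_apply_op:
  assumes "B \<subseteq> diff_ops U"
  shows "Lin_fun ((\<lambda>p. apply_op p \<phi>) ` B) = (\<lambda>p. apply_op p \<phi>) ` Lin_op B"
proof
  have sub: "op.span B \<subseteq> diff_ops U"
    using Lin_op_subset_diff_ops[OF assms] by (simp add: Lin_op_def)
  have "fn.subspace ((\<lambda>p. apply_op p \<phi>) ` op.span B)"
  proof (rule fn.subspaceI)
    have "apply_op 0 \<phi> = 0" by (simp add: apply_op_def fun_eq_iff)
    then show "0 \<in> (\<lambda>p. apply_op p \<phi>) ` op.span B"
      using op.span_zero[of B] by (metis imageI)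
  next
    fix f g assume "f \<in> (\<lambda>p. apply_op p \<phi>) ` op.span B" "g \<in> (\<lambda>p. apply_op p \<phi>) ` op.span B"
    then obtain p q where pq: "p \<in> op.span B" "q \<in> op.span B" "f = apply_op p \<phi>" "g = apply_op q \<phi>"
      by blast
    from pq(1,2) have "p \<in> diff_ops U" "q \<in> diff_ops U" using sub by blast+
    then have "f + g = apply_op (p + q) \<phi>"
      unfolding pq(3,4) by (rule apply_op_add_op[symmetric])
    with op.span_add[OF pq(1,2)] show "f + g \<in> (\<lambda>p. apply_op p \<phi>) ` op.span B" by blast
  next
    fix c f assume "f \<in> (\<lambda>p. apply_op p \<phi>) ` op.span B"
    then obtain p where p: "p \<in> op.span B" "f = apply_op p \<phi>" by blast
    from p(1) have "p \<in> diff_ops U" using sub by blast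
    then have "(\<lambda>x. c * f x) = apply_op (\<lambda>\<alpha> x. c * p \<alpha> x) \<phi>"
      unfolding p(2) by (rule apply_op_scale_op[symmetric])
    with op.span_scale[OF p(1), of c] show "(\<lambda>x. c * f x) \<in> (\<lambda>p. apply_op p \<phi>) ` op.span B" by blast
  qed
  then show "Lin_fun ((\<lambda>p. apply_op p \<phi>) ` B) \<subseteq> (\<lambda>p. apply_op p \<phi>) ` Lin_op B"
    unfolding Lin_fun_def Lin_op_def by (intro fn.span_minimal image_mono op.span_superset)
next
  have "apply_op p \<phi> \<in> fn.span ((\<lambda>p. apply_op p \<phi>) ` B) \<and> p \<in> diff_ops U" if "p \<in> op.span B" for p
    using that
  proof (induction rule: op.span_induct_alt)
    case base
    have "apply_op 0 \<phi> = 0" by (simp add: apply_op_def fun_eq_iff)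
    then have "apply_op 0 \<phi> \<in> fn.span ((\<lambda>p. apply_op p \<phi>) ` B)"
      by (simp only: fn.span_zero)
    then show ?case
      using op.subspace_0[OF subspace_diff_ops] by (rule conjI)
  next
    case (step c p q)
    let ?cp = "\<lambda>\<alpha> x. c * p \<alpha> x"
    have p: "p \<in> diff_ops U" using step assms by blast
    then have cp: "?cp \<in> diff_ops U" by (rule op.subspace_scale[OF subspace_diff_ops])
    have "apply_op (?cp + q) \<phi> = (\<lambda>x. c * apply_op p \<phi> x) + apply_op q \<phi>"
      using apply_op_add_op[OF cp, of q \<phi>] step by (simp add: apply_op_scale_op[OF p])
    also have "\<dots> \<in> fn.span ((\<lambda>p. apply_op p \<phi>) ` B)"
    proof (rule fn.span_add, rule fn.span_scale, rule fn.span_base)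
      show "apply_op p \<phi> \<in> (\<lambda>p. apply_op p \<phi>) ` B" using step by blast
    qed (use step in blast)
    finally show ?case
      using op.subspace_add[OF subspace_diff_ops cp] step by blast
  qed
  then show "(\<lambda>p. apply_op p \<phi>) ` Lin_op B \<subseteq> Lin_fun ((\<lambda>p. apply_op p \<phi>) ` B)"
    unfolding Lin_fun_def Lin_op_def by blast
qed

lemma test_fun_continuous:
  assumes "open U" "\<phi> \<in> test_fun U"
  shows "continuous_on S (foldr partial_deriv js \<phi>)"
  by (intro differentiable_imp_continuous_on differentiable_at_imp_differentiable_on
      test_fun_differentiable[OF assms])

lemma apply_op_cont_fun:
  assumes "open U" "p \<in> diff_ops U" "\<phi> \<in> test_fun U"
  shows "apply_op p \<phi> \<in> cont_fun U"
proof -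
  have "continuous_on U (\<lambda>x. \<Sum>\<alpha> | p \<alpha> \<noteq> 0. p \<alpha> x * partial_D \<alpha> \<phi> x)"
    using assms(2) unfolding partial_D_eq_foldr
    by (intro continuous_on_sum continuous_on_mult test_fun_continuous[OF assms(1,3)])
      (auto simp: diff_ops_def cont_fun_def)
  then show ?thesis
    using assms(2) by (simp add: cont_fun_def apply_op_def[abs_def] diff_ops_def)
qed

section \<open>The pairing with test functions\<close>

text \<open>
  A function in \<open>cont_fun U\<close> may be unbounded and non-integrable near the boundary of \<open>U\<close>, but the product lives
  on the compact support of \<open>\<psi>\<close>.
\<close>

lemma pairing_integrable:
  assumes "open U" "g \<in> cont_fun U" "\<psi> \<in> test_fun U"
  shows "set_integrable lborel U (\<lambda>x. g x * \<psi> x)"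
proof -
  let ?K = "closure {x. \<psi> x \<noteq> 0}"
  have K: "compact ?K" "?K \<subseteq> U" using assms(3) unfolding test_fun_def by blast+
  have "continuous_on ?K g"
    using assms(2) K(2) continuous_on_subset unfolding cont_fun_def by blast
  moreover have "continuous_on ?K \<psi>"
    using test_fun_continuous[OF assms(1,3), of _ "[]"] by simp
  ultimately have "continuous_on ?K (\<lambda>x. g x * \<psi> x)" by (rule continuous_on_mult)
  then have "integrable lborel (\<lambda>x. indicator ?K x *\<^sub>R (g x * \<psi> x))"
    by (rule borel_integrable_compact[OF K(1)])
  also have "(\<lambda>x. indicator ?K x *\<^sub>R (g x * \<psi> x)) = (\<lambda>x. indicator U x *\<^sub>R (g x * \<psi> x))"
  proof
    fix x
    show "indicator ?K x *\<^sub>R (g x * \<psi> x) = indicator U x *\<^sub>R (g x * \<psi> x)"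
    proof (cases "\<psi> x = 0")
      case False
      then have "x \<in> ?K" by (intro subsetD[OF closure_subset] CollectI)
      with K(2) show ?thesis by (auto simp: indicator_def)
    qed simp
  qed
  finally show ?thesis by (simp add: set_integrable_def)
qed

lemma inner_on_linear_left:
  assumes "open U" "f \<in> cont_fun U" "g \<in> cont_fun U" "\<psi> \<in> test_fun U"
  shows "inner_on U (\<lambda>x. a * f x + b * g x) \<psi> = a * inner_on U f \<psi> + b * inner_on U g \<psi>"
proof -
  have "(\<lambda>x. (a * f x + b * g x) * \<psi> x) = (\<lambda>x. a * (f x * \<psi> x) + b * (g x * \<psi> x))"
    by (simp add: fun_eq_iff algebra_simps)
  then show ?thesis
    using pairing_integrable[OF assms(1,2,4)] pairing_integrable[OF assms(1,3,4)]
    by (simp add: inner_on_def)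
qed

lemma inner_on_linear_right:
  assumes "open U" "g \<in> cont_fun U" "\<phi> \<in> test_fun U" "\<psi> \<in> test_fun U"
  shows "inner_on U g (\<lambda>x. a * \<phi> x + b * \<psi> x) = a * inner_on U g \<phi> + b * inner_on U g \<psi>"
proof -
  have "(\<lambda>x. g x * (a * \<phi> x + b * \<psi> x)) = (\<lambda>x. a * (g x * \<phi> x) + b * (g x * \<psi> x))"
    by (simp add: fun_eq_iff algebra_simps)
  then show ?thesis
    using pairing_integrable[OF assms(1,2,3)] pairing_integrable[OF assms(1,2,4)]
    by (simp add: inner_on_def)
qed

text \<open>
  If \<open>g a \<noteq> 0\<close>, a nonnegative test function \<open>\<psi>\<close> with \<open>\<psi> a = 1\<close>, supported where \<open>g\<close> has the sign of
  \<open>g a\<close>, makes \<open>g a * g * \<psi>\<close> nonnegative and positive on a nonempty open set, which is no null set.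
\<close>

lemma inner_on_nondegenerate:
  fixes U :: "(real ^ 'd::{finite,linorder}) set"
  assumes "open U" "g \<in> cont_fun U" "\<And>\<psi>. \<psi> \<in> test_fun U \<Longrightarrow> inner_on U g \<psi> = 0"
  shows "g = 0"
proof -
  have cont: "continuous_on U g" and out: "\<And>x. x \<notin> U \<Longrightarrow> g x = 0"
    using assms(2) by (auto simp: cont_fun_def)
  have "g a = 0" for a
  proof (rule ccontr)
    assume "g a \<noteq> 0"
    let ?h = "\<lambda>x. g a * g x"
    let ?W = "U \<inter> ?h -` {0<..}"
    have "open ?W"
      using assms(1) by (intro continuous_open_preimage continuous_on_mult continuous_on_const cont) auto
    have "a \<in> ?W" using \<open>g a \<noteq> 0\<close> out[of a] by (auto simp: zero_less_mult_iff not_less_iff_gr_or_eq)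
    obtain \<psi> where \<psi>: "\<psi> \<in> test_fun ?W" "\<psi> a = 1" "\<And>x. \<psi> x \<ge> 0"
    proof (rule test_fun_delta_jet[OF \<open>open ?W\<close> \<open>a \<in> ?W\<close>, of "\<lambda>i. 0"])
      fix \<psi> assume *: "\<psi> \<in> test_fun ?W" "\<And>\<beta>. partial_D \<beta> \<psi> a = (if \<beta> = (\<lambda>i. 0) then 1 else 0)"
        "(\<lambda>i::'d. 0::nat) = (\<lambda>i. 0) \<Longrightarrow> \<forall>x. \<psi> x \<ge> 0"
      show thesis
        using *(2)[of "\<lambda>i. 0"] *(3)[OF refl] by (intro that[OF *(1)]) (auto simp: partial_D_order_zero)
    qed
    have \<psi>U: "\<psi> \<in> test_fun U"
      using test_fun_mono[OF \<open>open ?W\<close>, of U] \<psi>(1) by blast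
    have \<psi>0: "\<psi> x = 0" if "x \<notin> ?W" for x
      using test_fun_zero_outside[OF \<psi>(1) that, of "[]"] by simp
    have int: "integrable lborel (\<lambda>x. indicator U x * (g x * \<psi> x))"
      using pairing_integrable[OF assms(1,2) \<psi>U] by (simp add: set_integrable_def)
    have nonneg: "0 \<le> g a * (indicator U x * (g x * \<psi> x))" for x
    proof (cases "x \<in> ?W")
      case True
      then have "0 \<le> ?h x * \<psi> x" using \<psi>(3)[of x] by simp
      with True show ?thesis by (simp add: algebra_simps)
    qed (simp add: \<psi>0)
    define V where "V = ?W \<inter> \<psi> -` {0<..}"
    have "(LINT x|lborel. g a * (indicator U x * (g x * \<psi> x))) = g a * inner_on U g \<psi>"
      by (simp add: inner_on_def set_lebesgue_integral_def)
    also have "\<dots> = 0" using assms(3)[OF \<psi>U] by simp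
    finally have "AE x in lborel. g a * (indicator U x * (g x * \<psi> x)) = 0"
      using integral_nonneg_eq_0_iff_AE[OF integrable_mult_right[OF int, of "g a"]] nonneg by simp
    then have "AE x in lborel. x \<notin> V"
      by (rule eventually_mono) (use \<open>g a \<noteq> 0\<close> in \<open>auto simp: V_def\<close>)
    moreover have "open V"
      unfolding V_def
    proof (rule continuous_open_preimage[OF _ \<open>open ?W\<close>])
      show "continuous_on ?W \<psi>" using test_fun_continuous[OF assms(1) \<psi>U, of ?W "[]"] by simp
    qed simp
    ultimately have "V \<in> null_sets lborel"
      by (subst AE_iff_null_sets) auto
    then have "negligible V"
      by (simp add: negligible_iff_null_sets null_sets_completionI)
    moreover have "a \<in> V" using \<open>a \<in> ?W\<close> \<psi>(2) by (simp add: V_def)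
    ultimately show False
      using open_not_negligible[OF \<open>open V\<close>] by blast
  qed
  then show ?thesis by (simp add: fun_eq_iff)
qed

text \<open>
  The fact that a functional vanishing on a finite intersection of kernels is a combination of the
  corresponding functionals, with nondegeneracy of the pairing as the base case.  For a further
  function \<open>a\<close>, either its functional already vanishes on the common kernel of the others and \<open>a\<close> can be dropped, or
  some \<open>\<psi>0\<close> in that kernel detects it; a multiple of \<open>a\<close> is then subtracted from \<open>g\<close> so that the
  difference pairs to zero with \<open>\<psi>0\<close>.
\<close>

lemma span_of_annihilator_inclusion:
  fixes U :: "(real ^ 'd::{finite,linorder}) set"
  assumes "open U" "finite B" "B \<subseteq> cont_fun U" "g \<in> cont_fun U"
    and "\<And>\<psi>. \<psi> \<in> test_fun U \<Longrightarrow> (\<And>b. b \<in> B \<Longrightarrow> inner_on U b \<psi> = 0) \<Longrightarrow> inner_on U g \<psi> = 0"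
  shows "g \<in> Lin_fun B"
  using assms(2-5)
proof (induction B arbitrary: g)
  case empty
  then have "g = 0" by (intro inner_on_nondegenerate[OF \<open>open U\<close>]) auto
  then show ?case by (simp only: Lin_fun_def fn.span_zero)
next
  case (insert a B)
  have a: "a \<in> cont_fun U" and B: "B \<subseteq> cont_fun U" using insert.prems by auto
  show ?case
  proof (cases "\<exists>\<psi>\<in>test_fun U. (\<forall>b\<in>B. inner_on U b \<psi> = 0) \<and> inner_on U a \<psi> \<noteq> 0")
    case False
    have "g \<in> Lin_fun B"
      by (rule insert.IH[OF B insert.prems(2)]) (use False insert.prems(3) in blast)
    then show ?thesis
      unfolding Lin_fun_def using fn.span_mono[of B "insert a B"] by blast
  next
    case True
    then obtain \<psi>0 where \<psi>0: "\<psi>0 \<in> test_fun U" "\<And>b. b \<in> B \<Longrightarrow> inner_on U b \<psi>0 = 0" "inner_on U a \<psi>0 \<noteq> 0"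
      by blast
    define k where "k = inner_on U g \<psi>0 / inner_on U a \<psi>0"
    let ?g = "\<lambda>x. 1 * g x + (- k) * a x"
    have "?g \<in> Lin_fun B"
    proof (rule insert.IH[OF B])
      show "?g \<in> cont_fun U"
        using insert.prems(2) a by (auto simp: cont_fun_def intro!: continuous_intros)
    next
      fix \<psi> assume \<psi>: "\<psi> \<in> test_fun U" "\<And>b. b \<in> B \<Longrightarrow> inner_on U b \<psi> = 0"
      \<comment> \<open>Project \<open>\<psi>\<close> along \<open>\<psi>0\<close> into the kernel of \<open>a\<close>.\<close>
      let ?c = "inner_on U a \<psi> / inner_on U a \<psi>0"
      let ?\<psi> = "\<lambda>x. 1 * \<psi> x + (- ?c) * \<psi>0 x"
      have pair: "inner_on U f ?\<psi> = inner_on U f \<psi> - ?c * inner_on U f \<psi>0" if "f \<in> cont_fun U" for f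
        by (subst inner_on_linear_right[OF \<open>open U\<close> that \<psi>(1) \<psi>0(1)]) simp
      have "inner_on U g ?\<psi> = 0"
      proof (rule insert.prems(3))
        show "?\<psi> \<in> test_fun U" by (rule test_fun_linear[OF \<open>open U\<close> \<psi>(1) \<psi>0(1)])
        show "inner_on U b ?\<psi> = 0" if "b \<in> insert a B" for b
        proof (cases "b = a")
          case True
          with \<psi>0(3) show ?thesis by (simp only: pair[OF a]) simp
        next
          case False
          with that have "b \<in> B" by simp
          then have "b \<in> cont_fun U" using B by blast
          then show ?thesis by (simp only: pair \<psi>(2)[OF \<open>b \<in> B\<close>] \<psi>0(2)[OF \<open>b \<in> B\<close>])
        qed
      qed
      then have "inner_on U g \<psi> = k * inner_on U a \<psi>"
        unfolding pair[OF insert.prems(2)] k_def by simp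
      then show "inner_on U ?g \<psi> = 0"
        by (subst inner_on_linear_left[OF \<open>open U\<close> insert.prems(2) a \<psi>(1)]) simp
    qed
    also have "?g = g - (\<lambda>x. k * a x)" by (simp add: fun_eq_iff)
    finally show ?thesis
      unfolding Lin_fun_def fn.span_breakdown_eq by blast
  qed
qed

section \<open>Reflexivity of spans of differential operators\<close>

text \<open>
  The coefficients are continuous on \<open>U\<close>, and \<open>\<real>\<^sup>d\<close> with \<open>d \<ge> 1\<close> has no nonempty finite open subsets,
  so a coefficient cannot be nonzero at finitely many points only.
\<close>

lemma diff_op_zero_off_finite:
  fixes U :: "(real ^ 'd::{finite,linorder}) set"
  assumes "open U" "p \<in> diff_ops U" "finite X" "\<And>\<alpha> x. x \<in> U - X \<Longrightarrow> p \<alpha> x = 0"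
  shows "p = 0"
proof -
  have "p \<alpha> x = 0" for \<alpha> x
  proof (rule ccontr)
    assume nz: "p \<alpha> x \<noteq> 0"
    have cont: "continuous_on U (p \<alpha>)" and out: "\<And>y. y \<notin> U \<Longrightarrow> p \<alpha> y = 0"
      using assms(2) by (auto simp: diff_ops_def cont_fun_def)
    let ?W = "U \<inter> p \<alpha> -` (- {0})"
    have "open ?W"
      using cont \<open>open U\<close> by (rule continuous_open_preimage) auto
    moreover have "x \<in> ?W" using nz out by auto
    moreover have "finite ?W"
      using assms(4) by (intro finite_subset[OF _ \<open>finite X\<close>]) auto
    ultimately show False
      using finite_imp_not_open[of ?W] by blast
  qed
  then show ?thesis by (simp add: fun_eq_iff)
qed

text \<open>
  A new operator \<open>b\<close> enlarges the space of operators that vanish at the chosen evaluations to dimension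
  at most one.  If that space contains some \<open>p \<noteq> 0\<close>, one more evaluation, at which \<open>p\<close> does not vanish,
  reduces it to zero.  The new point can be taken outside \<open>X\<close>, which keeps the number of multi-indices
  per point at one; prescribing jets independently relies on this.
\<close>

lemma separating_jets:
  fixes U :: "(real ^ 'd::{finite,linorder}) set"
  assumes "finite B" "B \<subseteq> diff_ops U" "open U"
  shows "\<exists>X A. finite X \<and> X \<subseteq> U \<and> (\<forall>p\<in>Lin_op B. (\<forall>x\<in>X. p (A x) x = 0) \<longrightarrow> p = 0)"
  using assms(1,2)
proof induction
  case empty
  show ?case
    by (rule exI[of _ "{}"]) (auto simp: Lin_op_def op.span_empty)
next
  case (insert b B)
  then obtain X A where X: "finite X" "X \<subseteq> U"
    and sep: "\<And>p. p \<in> op.span B \<Longrightarrow> (\<And>x. x \<in> X \<Longrightarrow> p (A x) x = 0) \<Longrightarrow> p = 0"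
    unfolding Lin_op_def by (metis insert_subset)
  show ?case
  proof (cases "\<forall>p\<in>op.span (insert b B). (\<forall>x\<in>X. p (A x) x = 0) \<longrightarrow> p = 0")
    case True
    with X show ?thesis unfolding Lin_op_def by blast
  next
    case False
    then obtain p where p: "p \<in> op.span (insert b B)" "\<And>x. x \<in> X \<Longrightarrow> p (A x) x = 0" "p \<noteq> 0"
      by blast
    have "p \<in> diff_ops U"
      using p(1) Lin_op_subset_diff_ops[OF insert.prems] unfolding Lin_op_def by blast
    then obtain \<alpha> y where y: "y \<in> U - X" "p \<alpha> y \<noteq> 0"
      using diff_op_zero_off_finite[OF \<open>open U\<close> _ X(1)] p(3) by blast
    define A' where "A' = A(y := \<alpha>)"
    have "q = 0" if q: "q \<in> op.span (insert b B)" "\<And>x. x \<in> insert y X \<Longrightarrow> q (A' x) x = 0" for q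
    proof -
      have qX: "q (A x) x = 0" if "x \<in> X" for x
        using q(2)[of x] that y(1) by (auto simp: A'_def split: if_splits)
      have qy: "q \<alpha> y = 0" using q(2)[of y] by (simp add: A'_def)
      obtain k where k: "p - (\<lambda>\<beta> x. k * b \<beta> x) \<in> op.span B"
        using p(1) op.span_breakdown_eq by blast
      obtain l where l: "q - (\<lambda>\<beta> x. l * b \<beta> x) \<in> op.span B"
        using q(1) op.span_breakdown_eq by blast
      have "k \<noteq> 0"
      proof
        assume "k = 0"
        then have "p - (\<lambda>\<beta> x. k * b \<beta> x) = p" by (simp add: fun_eq_iff)
        with k sep p(2,3) show False by simp
      qed
      \<comment> \<open>Eliminating \<open>b\<close> between \<open>q\<close> and \<open>p\<close> lands in the span of \<open>B\<close>, where the old evaluations separate.\<close>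
      let ?c = "l / k"
      have eq: "(q - (\<lambda>\<beta> x. l * b \<beta> x)) - (\<lambda>\<beta> x. ?c * (p - (\<lambda>\<beta> x. k * b \<beta> x)) \<beta> x) =
          q - (\<lambda>\<beta> x. ?c * p \<beta> x)"
        using \<open>k \<noteq> 0\<close> by (simp add: fun_eq_iff algebra_simps)
      have "q - (\<lambda>\<beta> x. ?c * p \<beta> x) \<in> op.span B"
        using op.span_diff[OF l op.span_scale[OF k, of ?c]] unfolding eq .
      then have qp: "q - (\<lambda>\<beta> x. ?c * p \<beta> x) = 0"
        by (rule sep) (simp add: qX p(2))
      then have q_eq: "q \<beta> x = ?c * p \<beta> x" for \<beta> x
        by (metis (mono_tags) fun_diff_def eq_iff_diff_eq_0 zero_fun_def)
      with qy y(2) have "?c = 0" by (metis mult_eq_0_iff)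
      with q_eq show "q = 0" by (simp add: fun_eq_iff)
    qed
    then have "\<forall>p\<in>op.span (insert b B). (\<forall>x\<in>insert y X. p (A' x) x = 0) \<longrightarrow> p = 0"
      by blast
    moreover have "finite (insert y X)" "insert y X \<subseteq> U"
      using X y(1) by auto
    ultimately show ?thesis
      unfolding Lin_op_def by blast
  qed
qed

text \<open>
  The values on \<open>X\<close> determine which element of the span represents \<open>L\<close> on a function whose jets on \<open>X\<close>
  are those of \<open>\<Phi>\<close>.  All functions \<open>\<Phi> + \<phi>\<close> with \<open>\<phi>\<close> supported off \<open>X\<close> are of this kind, so one operator
  \<open>P\<close> works for all of them at once.
\<close>

lemma Lin_op_reflexive:
  fixes U :: "(real ^ 'd::{finite,linorder}) set"
  assumes "open U" "finite B" "B \<subseteq> diff_ops U" "L \<in> diff_ops U"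
    and "\<And>\<phi>. \<phi> \<in> test_fun U \<Longrightarrow> \<exists>P\<in>Lin_op B. apply_op L \<phi> = apply_op P \<phi>"
  shows "L \<in> Lin_op B"
proof -
  have Lin: "p \<in> diff_ops U" if "p \<in> Lin_op B" for p
    using that Lin_op_subset_diff_ops[OF assms(3)] by blast
  obtain X A where XA: "finite X \<and> X \<subseteq> U \<and> (\<forall>p\<in>Lin_op B. (\<forall>x\<in>X. p (A x) x = 0) \<longrightarrow> p = 0)"
    using separating_jets[OF assms(2,3,1)] by (elim exE) (rule that)
  then have X: "finite X" "X \<subseteq> U" by blast+
  obtain \<Phi> where \<Phi>: "\<Phi> \<in> test_fun U"
    and jet: "\<forall>x\<in>X. \<forall>\<beta>. partial_D \<beta> \<Phi> x = (if \<beta> = A x then 1 else 0)"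
    using test_fun_interpolating_jets[OF X \<open>open U\<close>, of A] by (elim bexE) (rule that)
  obtain P where P: "P \<in> Lin_op B" "apply_op L \<Phi> = apply_op P \<Phi>"
    using assms(5)[OF \<Phi>] by blast
  have op: "open (U - X)" using \<open>open U\<close> X(1) by (intro open_Diff finite_imp_closed)
  have same: "apply_op L \<phi> = apply_op P \<phi>" if "\<phi> \<in> test_fun (U - X)" for \<phi>
  proof -
    have \<phi>: "\<phi> \<in> test_fun U" using that test_fun_mono[OF op, of U] by blast
    let ?\<Psi> = "\<lambda>x. 1 * \<Phi> x + 1 * \<phi> x"
    have \<Psi>: "?\<Psi> \<in> test_fun U" by (rule test_fun_linear[OF \<open>open U\<close> \<Phi> \<phi>])
    then obtain Q where Q: "Q \<in> Lin_op B" "apply_op L ?\<Psi> = apply_op Q ?\<Psi>"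
      using assms(5) by blast
    have add: "apply_op p ?\<Psi> x = apply_op p \<Phi> x + apply_op p \<phi> x" for p x
      by (subst apply_op_linear[OF \<open>open U\<close> \<Phi> \<phi>]) simp
    have "(Q - P) (A x) x = 0" if "x \<in> X" for x
    proof -
      have "apply_op p \<phi> x = 0" for p
        unfolding apply_op_def
        by (rule sum.neutral) (use partial_D_zero_outside[OF \<open>\<phi> \<in> test_fun (U - X)\<close>, of x] that in auto)
      then have "apply_op Q \<Phi> x = apply_op P \<Phi> x"
        using add[of L x] add[of Q x] P(2) Q(2) by simp
      then show ?thesis
        using apply_op_jet[OF Lin[OF P(1)] jet[rule_format, OF that]] apply_op_jet[OF Lin[OF Q(1)] jet[rule_format, OF that]]
        by simp
    qed
    moreover have "Q - P \<in> Lin_op B"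
      using P(1) Q(1) unfolding Lin_op_def by (intro op.span_diff)
    ultimately have "Q - P = 0" using XA by blast
    then have "Q = P" by simp
    show ?thesis
    proof
      fix x
      show "apply_op L \<phi> x = apply_op P \<phi> x"
        using add[of L x] add[of P x] P(2) Q(2) \<open>Q = P\<close> by simp
    qed
  qed
  have diff: "L - P \<in> diff_ops U"
    using op.subspace_diff[OF subspace_diff_ops] assms(4) Lin[OF P(1)] by blast
  have "(L - P) \<alpha> x = 0" if x: "x \<in> U - X" for \<alpha> x
  proof (rule test_fun_delta_jet[OF op x, of \<alpha>])
    fix \<phi> assume \<phi>: "\<phi> \<in> test_fun (U - X)" "\<And>\<beta>. partial_D \<beta> \<phi> x = (if \<beta> = \<alpha> then 1 else 0)"
    have "L \<alpha> x = P \<alpha> x"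
      using apply_op_jet[OF assms(4) \<phi>(2)] apply_op_jet[OF Lin[OF P(1)] \<phi>(2)] same[OF \<phi>(1)] by simp
    then show "(L - P) \<alpha> x = 0" by simp
  qed
  then have "L - P = 0"
    by (rule diff_op_zero_off_finite[OF \<open>open U\<close> diff X(1)])
  then show ?thesis using P(1) by simp
qed

theorem corollary1:
  fixes U :: "(real ^ 'd::{finite,linorder}) set"
    and r :: nat
    and Ls :: "nat \<Rightarrow> 'd diff_op"
    and L :: "'d diff_op"
  assumes "open U"
    and "\<And>i. i \<in> {1..r} \<Longrightarrow> Ls i \<in> diff_ops U"
    and "L \<in> diff_ops U"
  shows "((\<forall>\<phi>\<in>test_fun U. \<forall>\<psi>\<in>test_fun U.
            (\<forall>i\<in>{1..r}. inner_on U (apply_op (Ls i) \<phi>) \<psi> = 0) \<longrightarrow>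
            inner_on U (apply_op L \<phi>) \<psi> = 0)
          \<longleftrightarrow> (\<forall>\<phi>\<in>test_fun U. apply_op L \<phi> \<in> Lin_fun ((\<lambda>i. apply_op (Ls i) \<phi>) ` {1..r})))
       \<and> ((\<forall>\<phi>\<in>test_fun U. apply_op L \<phi> \<in> Lin_fun ((\<lambda>i. apply_op (Ls i) \<phi>) ` {1..r}))
          \<longleftrightarrow> L \<in> Lin_op (Ls ` {1..r}))"
    (is "(?orth \<longleftrightarrow> ?loc) \<and> (?loc \<longleftrightarrow> ?span)")
proof -
  have B: "Ls ` {1..r} \<subseteq> diff_ops U" using assms(2) by blast
  have cont: "apply_op (Ls i) \<phi> \<in> cont_fun U" if "i \<in> {1..r}" "\<phi> \<in> test_fun U" for i \<phi>
    using apply_op_cont_fun[OF assms(1) assms(2)[OF that(1)] that(2)] .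
  have span: "Lin_fun ((\<lambda>i. apply_op (Ls i) \<phi>) ` {1..r}) = (\<lambda>p. apply_op p \<phi>) ` Lin_op (Ls ` {1..r})" for \<phi>
    using Lin_fun_apply_op[OF B, of \<phi>] by (simp only: image_image)
  have "?loc" if ?orth
  proof
    fix \<phi> assume \<phi>: "\<phi> \<in> test_fun U"
    show "apply_op L \<phi> \<in> Lin_fun ((\<lambda>i. apply_op (Ls i) \<phi>) ` {1..r})"
    proof (rule span_of_annihilator_inclusion[OF assms(1)])
      show "(\<lambda>i. apply_op (Ls i) \<phi>) ` {1..r} \<subseteq> cont_fun U" using cont \<phi> by blast
      show "apply_op L \<phi> \<in> cont_fun U" by (rule apply_op_cont_fun[OF assms(1,3) \<phi>])
      fix \<psi> assume \<psi>: "\<psi> \<in> test_fun U"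
        "\<And>b. b \<in> (\<lambda>i. apply_op (Ls i) \<phi>) ` {1..r} \<Longrightarrow> inner_on U b \<psi> = 0"
      then have "\<forall>i\<in>{1..r}. inner_on U (apply_op (Ls i) \<phi>) \<psi> = 0" by blast
      with that \<phi> \<psi>(1) show "inner_on U (apply_op L \<phi>) \<psi> = 0" by blast
    qed simp
  qed
  moreover have "?orth" if ?loc
  proof (intro ballI impI)
    fix \<phi> \<psi> assume \<phi>: "\<phi> \<in> test_fun U" and \<psi>: "\<psi> \<in> test_fun U"
      and zero: "\<forall>i\<in>{1..r}. inner_on U (apply_op (Ls i) \<phi>) \<psi> = 0"
    have "fn.subspace {f \<in> cont_fun U. inner_on U f \<psi> = 0}"
    proof (rule fn.subspaceI)
      show "0 \<in> {f \<in> cont_fun U. inner_on U f \<psi> = 0}"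
        using fn.subspace_0[OF subspace_cont_fun] by (simp add: inner_on_def set_lebesgue_integral_def)
    next
      fix f g assume "f \<in> {f \<in> cont_fun U. inner_on U f \<psi> = 0}" "g \<in> {f \<in> cont_fun U. inner_on U f \<psi> = 0}"
      then show "f + g \<in> {f \<in> cont_fun U. inner_on U f \<psi> = 0}"
        using inner_on_linear_left[OF assms(1) _ _ \<psi>, of f g 1 1] fn.subspace_add[OF subspace_cont_fun, of f U g]
        by (simp add: plus_fun_def)
    next
      fix c f assume "f \<in> {f \<in> cont_fun U. inner_on U f \<psi> = 0}"
      then show "(\<lambda>x. c * f x) \<in> {f \<in> cont_fun U. inner_on U f \<psi> = 0}"
        using inner_on_linear_left[OF assms(1) _ _ \<psi>, of f f c 0] fn.subspace_scale[OF subspace_cont_fun, of f U c]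
        by simp
    qed
    moreover have "(\<lambda>i. apply_op (Ls i) \<phi>) ` {1..r} \<subseteq> {f \<in> cont_fun U. inner_on U f \<psi> = 0}"
      using zero cont \<phi> by blast
    ultimately have "Lin_fun ((\<lambda>i. apply_op (Ls i) \<phi>) ` {1..r}) \<subseteq> {f \<in> cont_fun U. inner_on U f \<psi> = 0}"
      unfolding Lin_fun_def by (intro fn.span_minimal)
    with that \<phi> show "inner_on U (apply_op L \<phi>) \<psi> = 0" by blast
  qed
  moreover have "?span" if ?loc
  proof (rule Lin_op_reflexive[OF assms(1) _ B assms(3)])
    show "\<exists>P\<in>Lin_op (Ls ` {1..r}). apply_op L \<phi> = apply_op P \<phi>" if "\<phi> \<in> test_fun U" for \<phi>
      using \<open>?loc\<close> that unfolding span by blast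
  qed simp
  moreover have "?loc" if ?span
    using that unfolding span by blast
  ultimately show ?thesis by blast
qed

end
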